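(* Let $\kappa\in\{1,-1\}$ and let $\hat G=\mathbb R^2\times\mathbb R\times\mathbb R^2$ be the transvection group of $N(\kappa)$ with stabiliser $\hat G_+=\{(0,\hat a,0)\mid\hat a\in\mathbb R\}$. The map $$\Phi:\ N(\kappa)=\hat G/\hat G_+\longrightarrow\mathbb R^2\times\mathbb R^2,\qquad(z,a,l)\hat G_+\longmapsto(v,u):=(z-\kappa al,\ l)$$ is a diffeomorphism. Under this diffeomorphism the metric on $N(\kappa)$ becomes $$-\tfrac\kappa3(u_2\,du_1-u_1\,du_2)^2+2(du_1\,dv_2-du_2\,dv_1).$$ The action of the isometry group $\hat G\rtimes\mathrm{SL}^\pm(2,\mathbb R)$ is given by $$(z,a,l)\cdot S\cdot(v,u)=\Big(\det(S)\,Sv+z-\tfrac\kappa3\,\alpha(l,Su)\big(Su+\tfrac12l\big)-\kappa a(Su+l),\ \ Su+l\Big).$$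
   Context: $\alpha(l,\hat l)=l_1\hat l_2-l_2\hat l_1$ for $l,\hat l\in\mathbb R^2$; $\mathrm{SL}^\pm(2,\mathbb R)=\{S\in\mathrm{GL}(2,\mathbb R)\mid\det S=\pm1\}$. $N(\kappa)$ is the simply-connected pseudo-Riemannian symmetric space $\tilde G/\tilde G_+$ defined by the following data. The Lie algebra $\hat{\mathfrak g}$ has basis $\sigma^1,\sigma^2,a_0,e_1,e_2$ with non-vanishing brackets $[e_1,e_2]=a_0$, $[e_1,a_0]=-\kappa\sigma^2$, $[e_2,a_0]=\kappa\sigma^1$ (up to antisymmetry); the $\operatorname{ad}$-invariant inner product is given by $\langle\sigma^i,e_j\rangle=\delta_{ij}$, $\langle a_0,a_0\rangle=\kappa$, all other products of basis vectors zero; the involution $\theta$ is $-1$ on $\sigma^i,e_i$ and $+1$ on $a_0$. $\tilde G$ is the simply-connected Lie group with Lie algebra $\hat{\mathfrak g}$, $\tilde G_+$ its connected subgroup with Lie algebra $\hat{\mathfrak g}_+=\mathbb Ra_0$, and the metric is the $\tilde G$-invariant one that at the base point is the restriction of $\langle\cdot,\cdot\rangle$ to the $(-1)$-eigenspace $\hat{\mathfrak g}_-$ of $\theta$. Here $\tilde G$ acts effectively and equals the transvection group $\hat G$, which is identified with $\mathbb R^2\times\mathbb R\times\mathbb R^2$ with multiplication $$(z,a,l)\cdot(\hat z,\hat a,\hat l)=\Big(z+\hat z+\tfrac\kappa3\alpha(l,\hat l)(l+\tfrac12\hat l)+\kappa\hat al,\ a+\hat a+\tfrac12\alpha(l,\hat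 l),\ l+\hat l\Big),$$ where on the Lie algebra level $z+a+l\in\mathbb R^2\oplus\mathbb R\oplus\mathbb R^2$ corresponds to $-\alpha(z,\cdot)+a\,a_0+l_1e_1+l_2e_2$, with $-\alpha(z,\cdot)\in(\mathbb R^2)^*=\mathrm{span}\{\sigma^1,\sigma^2\}$ ($\sigma^i$ dual to $e_i$). The isometry group is identified with $\hat G\rtimes\mathrm{SL}^\pm(2,\mathbb R)$, where $S$ acts on $\hat G$ by $(z,a,l)\mapsto(\det(S)Sz,\det(S)a,Sl)$ and correspondingly on $\hat G/\hat G_+$. *)

theory Defs
  imports "HOL-Analysis.Analysis" "HOL-Algebra.Left_Coset"
begin

section \<open>Smooth maps between open subsets of Euclidean spaces\<close>

text \<open>\<open>Ck_on k U f\<close>: all iterated directional derivatives of \<open>f\<close> of order less than \<open>k\<close> are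
  Frechet differentiable, and those of order \<open>k\<close> are continuous, on the open set \<open>U\<close>.\<close>

primrec Ck_on ::
    "nat \<Rightarrow> 'a::euclidean_space set \<Rightarrow> ('a \<Rightarrow> 'b::real_normed_vector) \<Rightarrow> bool" where
  "Ck_on 0 U f \<longleftrightarrow> continuous_on U f"
| "Ck_on (Suc k) U f \<longleftrightarrow>
     (\<forall>x\<in>U. f differentiable (at x)) \<and>
     (\<forall>v. Ck_on k U (\<lambda>x. frechet_derivative f (at x) v))"

definition smooth_on :: "'a::euclidean_space set \<Rightarrow> ('a \<Rightarrow> 'b::real_normed_vector) \<Rightarrow> bool" where
  "smooth_on U f \<longleftrightarrow> (\<forall>k. Ck_on k U f)"


section \<open>The Lie algebra data defining the symmetric space\<close>

definition alpha :: "real^2 \<Rightarrow> real^2 \<Rightarrow> real" where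
  "alpha l m = l$1 * m$2 - l$2 * m$1"

text \<open>A triple \<open>(s, a, e)\<close> of this type, regarded as an element of the Lie algebra, stands for
  \<open>s\<^sub>1 \<sigma>\<^sup>1 + s\<^sub>2 \<sigma>\<^sup>2 + a a\<^sub>0 + e\<^sub>1 e\<^sub>1 + e\<^sub>2 e\<^sub>2\<close>.  The same type is used for the points \<open>(z, a, l)\<close> of the
  transvection group and for its tangent vectors at the identity; the latter are translated
  into Lie algebra coefficients by \<open>lie_of\<close> below.\<close>

type_synonym triple = "(real^2) \<times> real \<times> (real^2)"

definition sigma1 :: triple where "sigma1 = (axis 1 1, 0, 0)"
definition sigma2 :: triple where "sigma2 = (axis 2 1, 0, 0)"
definition a0 :: triple where "a0 = (0, 1, 0)"
definition e1 :: triple where "e1 = (0, 0, axis 1 1)"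
definition e2 :: triple where "e2 = (0, 0, axis 2 1)"

text \<open>The bilinear extension of the brackets of basis vectors, see \<open>lie_bracket_basis\<close>.\<close>

fun lie_bracket :: "real \<Rightarrow> triple \<Rightarrow> triple \<Rightarrow> triple" where
  "lie_bracket \<kappa> (s, a, e) (s', a', e') =
     (e$1 * e'$2 - e$2 * e'$1) *\<^sub>R a0
     + (e$1 * a' - a * e'$1) *\<^sub>R (- \<kappa> *\<^sub>R sigma2)
     + (e$2 * a' - a * e'$2) *\<^sub>R (\<kappa> *\<^sub>R sigma1)"

lemma lie_bracket_basis:
  "lie_bracket \<kappa> e1 e2 = a0"
  "lie_bracket \<kappa> e1 a0 = - \<kappa> *\<^sub>R sigma2"
  "lie_bracket \<kappa> e2 a0 = \<kappa> *\<^sub>R sigma1"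
  "lie_bracket \<kappa> sigma1 X = 0" "lie_bracket \<kappa> sigma2 X = 0"
  by (cases X; simp add: e1_def e2_def a0_def sigma1_def sigma2_def axis_def zero_prod_def)+

fun lie_form :: "real \<Rightarrow> triple \<Rightarrow> triple \<Rightarrow> real" where
  "lie_form \<kappa> (s, a, e) (s', a', e') = s \<bullet> e' + e \<bullet> s' + \<kappa> * a * a'"

fun theta :: "triple \<Rightarrow> triple" where
  "theta (s, a, e) = (- s, a, - e)"

definition lie_minus :: "triple set" where
  "lie_minus = {X. theta X = - X}"

text \<open>The element \<open>-\<alpha>(z, \<cdot>) + a a\<^sub>0 + l\<^sub>1 e\<^sub>1 + l\<^sub>2 e\<^sub>2\<close> of the Lie algebra.  The coefficient at \<open>\<sigma>\<^sup>i\<close> of a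
  linear form is its value on \<open>e\<^sub>i\<close>.\<close>

fun lie_of :: "triple \<Rightarrow> triple" where
  "lie_of (z, a, l) = (\<chi> i. - alpha z (axis i 1), a, l)"


section \<open>The transvection group\<close>

fun Ghat_mult :: "real \<Rightarrow> triple \<Rightarrow> triple \<Rightarrow> triple" where
  "Ghat_mult \<kappa> (z, a, l) (z', a', l') =
     (z + z' + (\<kappa> / 3 * alpha l l') *\<^sub>R (l + (1/2) *\<^sub>R l') + (\<kappa> * a') *\<^sub>R l,
      a + a' + 1/2 * alpha l l',
      l + l')"

definition Ghat :: "real \<Rightarrow> triple monoid" where
  "Ghat \<kappa> = \<lparr>carrier = UNIV, mult = Ghat_mult \<kappa>, one = (0, 0, 0)\<rparr>"

definition Gplus :: "triple set" where
  "Gplus = {(0, a, 0) | a. True}"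

lemma alpha_simps:
  "alpha (l + l') m = alpha l m + alpha l' m" "alpha m (l + l') = alpha m l + alpha m l'"
  "alpha (c *\<^sub>R l) m = c * alpha l m" "alpha m (c *\<^sub>R l) = c * alpha m l"
  "alpha (- l) m = - alpha l m" "alpha m (- l) = - alpha m l"
  "alpha l l = 0" "alpha 0 m = 0" "alpha m 0 = 0"
  by (simp_all add: alpha_def algebra_simps)

lemma bounded_bilinear_alpha: "bounded_bilinear alpha"
  unfolding bilinear_conv_bounded_bilinear[symmetric] bilinear_def
  by (auto intro!: linearI simp: alpha_simps)

lemmas has_derivative_alpha [derivative_intros] =
  bounded_bilinear.FDERIV[OF bounded_bilinear_alpha]

lemma Ghat_mult_assoc:
  "Ghat_mult \<kappa> (Ghat_mult \<kappa> x y) w = Ghat_mult \<kappa> x (Ghat_mult \<kappa> y w)"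
  by (cases x; cases y; cases w)
    (simp add: vec_eq_iff forall_2 alpha_def field_simps)

lemma group_Ghat: "group (Ghat \<kappa>)"
proof (rule groupI)
  fix x assume "x \<in> carrier (Ghat \<kappa>)"
  obtain z a l where x: "x = (z, a, l)" by (cases x)
  have "Ghat_mult \<kappa> (- z + (\<kappa> * a) *\<^sub>R l, - a, - l) x = (0, 0, 0)"
    by (simp add: x alpha_simps)
  then show "\<exists>y\<in>carrier (Ghat \<kappa>). y \<otimes>\<^bsub>Ghat \<kappa>\<^esub> x = \<one>\<^bsub>Ghat \<kappa>\<^esub>"
    by (auto simp: Ghat_def)
qed (auto simp: Ghat_def Ghat_mult_assoc alpha_simps)

lemma subgroup_Gplus: "subgroup Gplus (Ghat \<kappa>)"
proof (rule group.subgroupI[OF group_Ghat])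
  fix x assume "x \<in> Gplus"
  then obtain a where x: "x = (0, a, 0)" by (auto simp: Gplus_def)
  have "inv\<^bsub>Ghat \<kappa>\<^esub> x = (0, - a, 0)"
    by (rule group.inv_equality[OF group_Ghat]) (auto simp: Ghat_def x alpha_simps)
  then show "inv\<^bsub>Ghat \<kappa>\<^esub> x \<in> Gplus" by (simp add: Gplus_def)
qed (auto simp: Gplus_def Ghat_def alpha_simps)

text \<open>Differentiating the multiplication gives the left-invariant vector fields; \<open>Ghat_bracket\<close>
  shows that their commutator at the identity is the prescribed Lie bracket, that is, \<open>lie_of\<close>
  is the isomorphism from the Lie algebra of the group onto the Lie algebra above.\<close>

definition left_inv_field :: "real \<Rightarrow> triple \<Rightarrow> triple \<Rightarrow> triple" where
  "left_inv_field \<kappa> X g = frechet_derivative (\<lambda>h. g \<otimes>\<^bsub>Ghat \<kappa>\<^esub> h) (at 0) X"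

lemma left_inv_field_eq:
  "left_inv_field \<kappa> (z', a', l') (z, a, l) =
     (z' + (\<kappa> / 3 * alpha l l') *\<^sub>R l + (\<kappa> * a') *\<^sub>R l, a' + 1/2 * alpha l l', l')"
proof -
  have split: "Ghat_mult \<kappa> (z, a, l) =
     (\<lambda>h. (z + fst h + (\<kappa> / 3 * alpha l (snd (snd h))) *\<^sub>R (l + (1/2) *\<^sub>R snd (snd h))
              + (\<kappa> * fst (snd h)) *\<^sub>R l,
           a + fst (snd h) + 1/2 * alpha l (snd (snd h)), l + snd (snd h)))"
    by (auto simp: fun_eq_iff)
  have "((\<lambda>h. Ghat_mult \<kappa> (z, a, l) h) has_derivative
     (\<lambda>h. (fst h + (\<kappa> / 3 * alpha l (snd (snd h))) *\<^sub>R l + (\<kappa> * fst (snd h)) *\<^sub>R l,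
           fst (snd h) + 1/2 * alpha l (snd (snd h)), snd (snd h)))) (at 0)"
    unfolding split
    by (rule derivative_eq_intros refl)+ (auto simp: fun_eq_iff alpha_simps)
  from frechet_derivative_at[OF this, symmetric]
  show ?thesis by (simp add: left_inv_field_def Ghat_def)
qed

lemma Ghat_bracket:
  "lie_of (frechet_derivative (left_inv_field \<kappa> Y) (at 0) X
           - frechet_derivative (left_inv_field \<kappa> X) (at 0) Y)
   = lie_bracket \<kappa> (lie_of X) (lie_of Y)"
proof -
  have deriv: "frechet_derivative (left_inv_field \<kappa> (z', a', l')) (at 0) (z, a, l) =
      ((\<kappa> * a') *\<^sub>R l, 1/2 * alpha l l', 0)" for z z' l l' :: "real^2" and a a' :: real
  proof -
    have split: "left_inv_field \<kappa> (z', a', l') =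
       (\<lambda>g. (z' + (\<kappa> / 3 * alpha (snd (snd g)) l') *\<^sub>R snd (snd g) + (\<kappa> * a') *\<^sub>R snd (snd g),
             a' + 1/2 * alpha (snd (snd g)) l', l'))"
      by (auto simp: fun_eq_iff left_inv_field_eq)
    have "(left_inv_field \<kappa> (z', a', l') has_derivative
       (\<lambda>g. ((\<kappa> * a') *\<^sub>R snd (snd g), 1/2 * alpha (snd (snd g)) l', 0))) (at 0)"
      unfolding split
      by (rule derivative_eq_intros refl)+ (auto simp: fun_eq_iff alpha_simps)
    from frechet_derivative_at[OF this, symmetric]
    show ?thesis by simp
  qed
  obtain z a l z' a' l' where "X = (z, a, l)" "Y = (z', a', l')"
    by (cases X; cases Y)
  then show ?thesis
    by (simp add: deriv vec_eq_iff forall_2 alpha_def axis_def a0_def sigma1_def sigma2_def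
        algebra_simps)
qed


section \<open>The symmetric space \<open>N(\<kappa>)\<close> as a smooth manifold\<close>

definition proj :: "real \<Rightarrow> triple \<Rightarrow> triple set" where
  "proj \<kappa> g = g <#\<^bsub>Ghat \<kappa>\<^esub> Gplus"

definition N :: "real \<Rightarrow> triple set set" where
  "N \<kappa> = lcosets\<^bsub>Ghat \<kappa>\<^esub> Gplus"

text \<open>The quotient topology.\<close>

definition N_topology :: "real \<Rightarrow> triple set topology" where
  "N_topology \<kappa> = topology (\<lambda>U. U \<subseteq> N \<kappa> \<and> open (proj \<kappa> -` U))"

lemma openin_N_topology:
  "openin (N_topology \<kappa>) U \<longleftrightarrow> U \<subseteq> N \<kappa> \<and> open (proj \<kappa> -` U)"
proof -
  have "istopology (\<lambda>U. U \<subseteq> N \<kappa> \<and> open (proj \<kappa> -` U))"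
    unfolding istopology_def
    by (auto simp: vimage_Int vimage_Union)
  then show ?thesis by (simp add: N_topology_def topology_inverse')
qed

text \<open>The smooth structure of the homogeneous space, given by its sheaf of smooth functions: since
  the projection is a surjective submersion, a function on an open set of cosets is smooth iff
  its composition with the projection is.\<close>

definition N_smooth_on ::
    "real \<Rightarrow> triple set set \<Rightarrow> (triple set \<Rightarrow> 'b::real_normed_vector) \<Rightarrow> bool" where
  "N_smooth_on \<kappa> U f \<longleftrightarrow> smooth_on (proj \<kappa> -` U) (f \<circ> proj \<kappa>)"

text \<open>A diffeomorphism onto a Euclidean space: a homeomorphism such that it and its inverse pull
  back smooth functions (on open sets) to smooth functions.\<close>

definition N_diffeomorphism ::
    "real \<Rightarrow> (triple set \<Rightarrow> 'b::euclidean_space) \<Rightarrow> bool" where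
  "N_diffeomorphism \<kappa> F \<longleftrightarrow>
     homeomorphic_map (N_topology \<kappa>) euclidean F \<and>
     (\<forall>V (f :: 'b \<Rightarrow> real). open V \<and> smooth_on V f \<longrightarrow>
        N_smooth_on \<kappa> {p \<in> N \<kappa>. F p \<in> V} (f \<circ> F)) \<and>
     (\<forall>U (f :: triple set \<Rightarrow> real). openin (N_topology \<kappa>) U \<and> N_smooth_on \<kappa> U f \<longrightarrow>
        smooth_on (F ` U) (f \<circ> inv_into (N \<kappa>) F))"


section \<open>Tangent vectors and the metric of \<open>N(\<kappa>)\<close>\<close>

text \<open>Tangent vectors are derivations of the algebra of smooth functions on \<open>N(\<kappa>)\<close>.
  \<open>dproj \<kappa> g X\<close> is the image under the differential of the projection of the tangent vector \<open>X\<close>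
  of the group at the point \<open>g\<close>.  As the projection is a submersion, these images exhaust the
  tangent spaces.\<close>

definition N_smooth_functions :: "real \<Rightarrow> (triple set \<Rightarrow> real) set" where
  "N_smooth_functions \<kappa> = {f. N_smooth_on \<kappa> (N \<kappa>) f}"

definition dproj :: "real \<Rightarrow> triple \<Rightarrow> triple \<Rightarrow> (triple set \<Rightarrow> real) \<Rightarrow> real" where
  "dproj \<kappa> g X = (\<lambda>f\<in>N_smooth_functions \<kappa>. frechet_derivative (f \<circ> proj \<kappa>) (at g) X)"

definition N_tangent_space :: "real \<Rightarrow> triple set \<Rightarrow> ((triple set \<Rightarrow> real) \<Rightarrow> real) set" where
  "N_tangent_space \<kappa> p = {dproj \<kappa> g X | g X. proj \<kappa> g = p}"

text \<open>The differential of a smooth map from \<open>N(\<kappa>)\<close> to a Euclidean space.\<close>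

definition N_differential ::
    "(triple set \<Rightarrow> 'b::euclidean_space) \<Rightarrow> ((triple set \<Rightarrow> real) \<Rightarrow> real) \<Rightarrow> 'b" where
  "N_differential F \<xi> = (\<Sum>b\<in>Basis. \<xi> (\<lambda>p. F p \<bullet> b) *\<^sub>R b)"

text \<open>Left translation by \<open>g\<close> on the coset space, and its differential.\<close>

definition transl :: "real \<Rightarrow> triple \<Rightarrow> triple set \<Rightarrow> triple set" where
  "transl \<kappa> g p = g <#\<^bsub>Ghat \<kappa>\<^esub> p"

definition dtransl ::
    "real \<Rightarrow> triple \<Rightarrow> ((triple set \<Rightarrow> real) \<Rightarrow> real) \<Rightarrow> (triple set \<Rightarrow> real) \<Rightarrow> real" where
  "dtransl \<kappa> g \<xi> = (\<lambda>f\<in>N_smooth_functions \<kappa>. \<xi> (f \<circ> transl \<kappa> g))"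

text \<open>The invariant metric which at the base point \<open>Gplus\<close>, whose tangent space is identified with
  the \<open>(-1)\<close>-eigenspace of \<open>theta\<close> by the differential of the projection, is the restriction of
  \<open>lie_form\<close>.\<close>

definition N_metric ::
    "real \<Rightarrow> triple set \<Rightarrow> ((triple set \<Rightarrow> real) \<Rightarrow> real) \<Rightarrow> ((triple set \<Rightarrow> real) \<Rightarrow> real) \<Rightarrow> real"
  where
  "N_metric \<kappa> p \<xi> \<eta> = (THE r. \<exists>g X Y.
      lie_of X \<in> lie_minus \<and> lie_of Y \<in> lie_minus \<and>
      p = transl \<kappa> g Gplus \<and>
      \<xi> = dtransl \<kappa> g (dproj \<kappa> \<one>\<^bsub>Ghat \<kappa>\<^esub> X) \<and>
      \<eta> = dtransl \<kappa> g (dproj \<kappa> \<one>\<^bsub>Ghat \<kappa>\<^esub> Y) \<and>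
      r = lie_form \<kappa> (lie_of X) (lie_of Y))"


section \<open>The isometry group and its action\<close>

definition SLpm :: "(real^2^2) set" where
  "SLpm = {S. det S = 1 \<or> det S = -1}"

fun SL_act :: "real^2^2 \<Rightarrow> triple \<Rightarrow> triple" where
  "SL_act S (z, a, l) = (det S *\<^sub>R (S *v z), det S * a, S *v l)"

text \<open>The semidirect product; \<open>((z, a, l), S)\<close> is the element \<open>(z, a, l) \<cdot> S\<close>.\<close>

definition isom_group :: "real \<Rightarrow> (triple \<times> (real^2^2)) monoid" where
  "isom_group \<kappa> = \<lparr>carrier = UNIV \<times> SLpm,
     mult = (\<lambda>(g, S) (g', S'). (g \<otimes>\<^bsub>Ghat \<kappa>\<^esub> SL_act S g', S ** S')),
     one = ((0, 0, 0), mat 1)\<rparr>"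

definition isom_act :: "real \<Rightarrow> triple \<times> (real^2^2) \<Rightarrow> triple set \<Rightarrow> triple set" where
  "isom_act \<kappa> = (\<lambda>(g, S) p. transl \<kappa> g (SL_act S ` p))"

lemma alpha_matrix: "alpha (S *v l) (S *v m) = det S * alpha l m"
  by (simp add: alpha_def matrix_vector_mult_def sum_2 det_2 algebra_simps)

lemma SL_act_mult:
  assumes "S \<in> SLpm"
  shows "SL_act S (Ghat_mult \<kappa> g h) = Ghat_mult \<kappa> (SL_act S g) (SL_act S h)"
proof -
  have "det S * det S = 1" using assms by (auto simp: SLpm_def)
  then show ?thesis
    by (cases g; cases h)
      (simp add: alpha_matrix matrix_vector_right_distrib matrix_vector_mult_scaleR algebra_simps)
qed

lemma isom_act_proj:
  assumes "S \<in> SLpm"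
  shows "isom_act \<kappa> (g, S) (proj \<kappa> x) = proj \<kappa> (g \<otimes>\<^bsub>Ghat \<kappa>\<^esub> SL_act S x)"
proof -
  have d: "det S * det S = 1" using assms by (auto simp: SLpm_def)
  have "SL_act S (0, det S * a, 0) = (0, a, 0)" for a
    by (simp add: d flip: mult.assoc)
  then have "(0, a, 0) \<in> SL_act S ` Gplus" for a
    by (metis (mono_tags, lifting) Gplus_def image_eqI mem_Collect_eq)
  then have "SL_act S ` Gplus = Gplus"
    by (auto simp: Gplus_def)
  then show ?thesis
    by (force simp: isom_act_def transl_def proj_def l_coset_def Ghat_def SL_act_mult[OF assms]
        Ghat_mult_assoc)
qed

lemma SL_act_matrix_mult: "SL_act S (SL_act T g) = SL_act (S ** T) g"
  by (cases g) (simp add: det_mul matrix_vector_mul_assoc[symmetric] matrix_vector_mult_scaleR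
      algebra_simps)

lemma group_isom_group: "group (isom_group \<kappa>)"
proof (rule groupI)
  fix x assume "x \<in> carrier (isom_group \<kappa>)"
  then obtain g S where x: "x = (g, S)" and S: "S \<in> SLpm" by (auto simp: isom_group_def)
  then have "invertible S" by (auto simp: SLpm_def invertible_det_nz)
  then obtain T where TS: "T ** S = mat 1" by (auto simp: invertible_def)
  then have "det T * det S = 1" by (metis det_mul det_I)
  with S have T: "T \<in> SLpm" by (auto simp: SLpm_def)
  obtain h where h: "Ghat_mult \<kappa> h (SL_act T g) = (0, 0, 0)"
    using group.l_inv_ex[OF group_Ghat, of "SL_act T g" \<kappa>] by (auto simp: Ghat_def)
  show "\<exists>y\<in>carrier (isom_group \<kappa>). y \<otimes>\<^bsub>isom_group \<kappa>\<^esub> x = \<one>\<^bsub>isom_group \<kappa>\<^esub>"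
    by (rule bexI[of _ "(h, T)"]) (auto simp: isom_group_def Ghat_def x TS T h)
next
  fix x y w
  assume "x \<in> carrier (isom_group \<kappa>)" "y \<in> carrier (isom_group \<kappa>)" "w \<in> carrier (isom_group \<kappa>)"
  then show "x \<otimes>\<^bsub>isom_group \<kappa>\<^esub> y \<otimes>\<^bsub>isom_group \<kappa>\<^esub> w =
      x \<otimes>\<^bsub>isom_group \<kappa>\<^esub> (y \<otimes>\<^bsub>isom_group \<kappa>\<^esub> w)"
    by (auto simp: isom_group_def Ghat_def Ghat_mult_assoc SL_act_mult SL_act_matrix_mult
        matrix_mul_assoc simp del: Ghat_mult.simps SL_act.simps)
qed (auto simp: isom_group_def Ghat_def alpha_simps SLpm_def det_mul)

lemma isom_act_mult:
  assumes "x \<in> carrier (isom_group \<kappa>)" "y \<in> carrier (isom_group \<kappa>)"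
  shows "isom_act \<kappa> x (isom_act \<kappa> y (proj \<kappa> g)) = isom_act \<kappa> (x \<otimes>\<^bsub>isom_group \<kappa>\<^esub> y) (proj \<kappa> g)"
proof -
  obtain h S k T where xy: "x = (h, S)" "y = (k, T)" by (cases x; cases y)
  with assms have "S \<in> SLpm" "T \<in> SLpm" "S ** T \<in> SLpm"
    by (auto simp: isom_group_def SLpm_def det_mul)
  then show ?thesis
    by (simp add: xy isom_group_def isom_act_proj)
      (simp add: Ghat_def SL_act_mult SL_act_matrix_mult Ghat_mult_assoc)
qed


section \<open>Forms on \<open>\<real>\<^sup>2 \<times> \<real>\<^sup>2\<close> with coordinates \<open>(v, u)\<close>\<close>

definition Phi :: "real \<Rightarrow> triple set \<Rightarrow> (real^2) \<times> (real^2)" where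
  "Phi \<kappa> p = (THE x. \<exists>z a l. p = proj \<kappa> (z, a, l) \<and> x = (z - (\<kappa> * a) *\<^sub>R l, l))"

definition dv :: "2 \<Rightarrow> (real^2) \<times> (real^2) \<Rightarrow> real" where
  "dv i w = fst w $ i"

definition du :: "2 \<Rightarrow> (real^2) \<times> (real^2) \<Rightarrow> real" where
  "du i w = snd w $ i"

text \<open>The symmetric product of one-forms as a bilinear form, normalised such that \<open>\<omega> \<omega> = \<omega> \<otimes> \<omega>\<close>.\<close>

definition sym_prod :: "('b \<Rightarrow> real) \<Rightarrow> ('b \<Rightarrow> real) \<Rightarrow> 'b \<Rightarrow> 'b \<Rightarrow> real" where
  "sym_prod \<omega> \<eta> x y = (\<omega> x * \<eta> y + \<eta> x * \<omega> y) / 2"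

definition coord_metric ::
    "real \<Rightarrow> (real^2) \<times> (real^2) \<Rightarrow> (real^2) \<times> (real^2) \<Rightarrow> (real^2) \<times> (real^2) \<Rightarrow> real" where
  "coord_metric \<kappa> = (\<lambda>(v, u) x y.
     let \<omega> = (\<lambda>w. u$2 * du 1 w - u$1 * du 2 w) in
     - (\<kappa> / 3) * sym_prod \<omega> \<omega> x y
     + 2 * (sym_prod (du 1) (dv 2) x y - sym_prod (du 2) (dv 1) x y))"

end

theory Submission
  imports Defs
begin

text \<open>The projection to \<open>N(\<kappa>)\<close> is the quotient by the fibres of the polynomial map
  \<open>(z, a, l) \<mapsto> (z - \<kappa> a l, l)\<close>, which has the linear section \<open>(v, u) \<mapsto> (v, 0, u)\<close>.  Hence smooth
  functions on \<open>N(\<kappa>)\<close> are exactly the pullbacks of smooth functions of \<open>(v, u)\<close>, and a tangent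
  vector is determined by its image in the \<open>(v, u)\<close>-coordinates.  The translate by \<open>(z, a, u)\<close> of
  \<open>(z', 0, l') \<in> \<gg>\<^sub>-\<close> has the image \<open>(z' - (\<kappa>/6) \<alpha>(u, l') u - \<kappa> a l', l')\<close>, and inserting this into
  the coordinate metric leaves \<open>\<alpha>(l, z') + \<alpha>(l', z)\<close>.\<close>

section \<open>Calculus of smooth maps\<close>

lemma Ck_on_Suc_has_derivative:
  assumes "Ck_on (Suc k) U f" "x \<in> U"
  shows "(f has_derivative frechet_derivative f (at x)) (at x)"
  using assms by (auto simp: frechet_derivative_works)

text \<open>As \<open>U\<close> is open, functions that agree on \<open>U\<close> agree near each of
  its points and have the same derivatives there; induction then passes to the directional
  derivatives.\<close>

lemma Ck_on_cong:
  assumes "open U" "\<And>x. x \<in> U \<Longrightarrow> f x = g x" "Ck_on k U f"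
  shows "Ck_on k U g"
  using assms(2,3)
proof (induction k arbitrary: f g)
  case 0
  then show ?case by (simp cong: continuous_on_cong)
next
  case (Suc k)
  have D: "(g has_derivative frechet_derivative f (at x)) (at x)" if "x \<in> U" for x
    using has_derivative_transform_within_open[OF Ck_on_Suc_has_derivative[OF Suc.prems(2) that]
        \<open>open U\<close> that] Suc.prems(1) by blast
  have "frechet_derivative f (at x) = frechet_derivative g (at x)" if "x \<in> U" for x
    using frechet_derivative_at[OF D[OF that]] .
  then have "Ck_on k U (\<lambda>x. frechet_derivative g (at x) v)" for v
    using Suc.IH[of "\<lambda>x. frechet_derivative f (at x) v" "\<lambda>x. frechet_derivative g (at x) v"] Suc.prems(2)
    by auto
  then show ?case using D by (auto simp: differentiable_def)
qed

text \<open>Since derivatives are unique, a derivative \<open>D\<close> found by calculus rules can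
  stand in for \<open>frechet_derivative\<close>; the sum, product and chain rules below all enter
  this way.\<close>

lemma Ck_on_SucI:
  assumes "open U" "\<And>x. x \<in> U \<Longrightarrow> (f has_derivative D x) (at x)" "\<And>v. Ck_on k U (\<lambda>x. D x v)"
  shows "Ck_on (Suc k) U f"
proof -
  have "Ck_on k U (\<lambda>x. frechet_derivative f (at x) v)" for v
    by (rule Ck_on_cong[OF assms(1) _ assms(3)]) (rule frechet_derivative_at[OF assms(2), THEN fun_cong])
  then show ?thesis using assms(2) by (auto simp: differentiable_def)
qed

lemma Ck_on_Suc_imp: "Ck_on (Suc k) U f \<Longrightarrow> Ck_on k U f"
proof (induction k arbitrary: f)
  case 0
  then show ?case
    by (auto intro!: continuous_at_imp_continuous_on differentiable_imp_continuous_within)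
next
  case (Suc k)
  from Suc.prems have "\<forall>x\<in>U. f differentiable (at x)"
    and "\<And>v. Ck_on (Suc k) U (\<lambda>x. frechet_derivative f (at x) v)"
    \<comment> \<open>Only the outer layer is unfolded, so that the directional derivatives keep the
      class \<open>Suc k\<close> which the induction hypothesis expects.\<close>
    by (subst (asm) (1) Ck_on.simps(2); blast)+
  with Suc.IH show ?case by (subst Ck_on.simps(2)) blast
qed

lemma Ck_on_const: "Ck_on k U (\<lambda>x. c)"
  by (induction k arbitrary: c) (simp_all add: frechet_derivative_const)

lemma Ck_on_add:
  assumes "open U" "Ck_on k U f" "Ck_on k U g"
  shows "Ck_on k U (\<lambda>x. f x + g x)"
  using assms(2,3)
proof (induction k arbitrary: f g)
  case 0
  then show ?case by (simp add: continuous_on_add)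
next
  case (Suc k)
  show ?case
  proof (rule Ck_on_SucI[OF assms(1)])
    fix x assume x: "x \<in> U"
    show "((\<lambda>x. f x + g x) has_derivative
        (\<lambda>v. frechet_derivative f (at x) v + frechet_derivative g (at x) v)) (at x)"
      by (intro has_derivative_add Suc.prems[THEN Ck_on_Suc_has_derivative, OF x])
  next
    fix v
    show "Ck_on k U (\<lambda>x. frechet_derivative f (at x) v + frechet_derivative g (at x) v)"
      using Suc.prems by (intro Suc.IH) auto
  qed
qed

lemma Ck_on_sum:
  assumes "open U" "\<And>b. b \<in> B \<Longrightarrow> Ck_on k U (f b)"
  shows "Ck_on k U (\<lambda>x. \<Sum>b\<in>B. f b x)"
  using assms(2)
  by (induction B rule: infinite_finite_induct) (simp_all add: Ck_on_const Ck_on_add[OF assms(1)])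

lemma (in bounded_linear) Ck_on:
  assumes "open U" "Ck_on k U g"
  shows "Ck_on k U (\<lambda>x. f (g x))"
  using assms(2)
proof (induction k arbitrary: g)
  case 0
  then show ?case by (simp add: continuous_on)
next
  case (Suc k)
  show ?case
  proof (rule Ck_on_SucI[OF assms(1)])
    fix x assume x: "x \<in> U"
    show "((\<lambda>x. f (g x)) has_derivative (\<lambda>v. f (frechet_derivative g (at x) v))) (at x)"
      by (intro has_derivative Suc.prems[THEN Ck_on_Suc_has_derivative, OF x])
  next
    fix v
    show "Ck_on k U (\<lambda>x. f (frechet_derivative g (at x) v))"
      using Suc.prems by (intro Suc.IH) auto
  qed
qed

lemma Ck_on_ident:
  assumes "open U"
  shows "Ck_on k U (\<lambda>x. x)"
proof (cases k)
  case (Suc n)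
  show ?thesis
    unfolding Suc by (rule Ck_on_SucI[OF assms, where D = "\<lambda>_ v. v"]) (auto intro: Ck_on_const)
qed simp

text \<open>The Leibniz rule pairs the derivative of one factor, of class \<open>k\<close>, with the
  other factor, of class \<open>Suc k\<close>; \<open>Ck_on_Suc_imp\<close> lowers the
  latter.\<close>

lemma (in bounded_bilinear) Ck_on:
  assumes "open U" "Ck_on k U f" "Ck_on k U g"
  shows "Ck_on k U (\<lambda>x. prod (f x) (g x))"
  using assms(2,3)
proof (induction k arbitrary: f g)
  case 0
  then show ?case by (simp add: continuous_on)
next
  case (Suc k)
  show ?case
  proof (rule Ck_on_SucI[OF assms(1)])
    fix x assume x: "x \<in> U"
    show "((\<lambda>x. prod (f x) (g x)) has_derivative
        (\<lambda>v. prod (f x) (frechet_derivative g (at x) v)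
             + prod (frechet_derivative f (at x) v) (g x))) (at x)"
      by (intro FDERIV Suc.prems[THEN Ck_on_Suc_has_derivative, OF x])
  next
    fix v
    show "Ck_on k U (\<lambda>x. prod (f x) (frechet_derivative g (at x) v)
             + prod (frechet_derivative f (at x) v) (g x))"
      using Suc.prems Suc.prems[THEN Ck_on_Suc_imp]
      by (intro Ck_on_add[OF assms(1)] Suc.IH) auto
  qed
qed

text \<open>In the chain rule the derivative of \<open>f\<close> is applied to a direction that
  varies with \<open>x\<close>, while the induction hypothesis speaks of fixed directions. Expanding
  the direction in \<open>Basis\<close> gives a sum of products: a component of the derivative of
  \<open>g\<close> times a basis derivative of \<open>f\<close> composed with
  \<open>g\<close>.\<close>

lemma Ck_on_compose:
  fixes g :: "'a::euclidean_space \<Rightarrow> 'b::euclidean_space"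
  assumes "open U" "g ` U \<subseteq> V" "Ck_on k V f" "Ck_on k U g"
  shows "Ck_on k U (\<lambda>x. f (g x))"
  using assms(3,4)
proof (induction k arbitrary: f)
  case 0
  then show ?case using continuous_on_compose2[of V f U g] assms(2) by simp
next
  case (Suc k)
  let ?D = "\<lambda>x v. \<Sum>b\<in>Basis. (frechet_derivative g (at x) v \<bullet> b) *\<^sub>R frechet_derivative f (at (g x)) b"
  show ?case
  proof (rule Ck_on_SucI[OF assms(1)])
    fix x assume x: "x \<in> U"
    then have gx: "g x \<in> V" using assms(2) by auto
    note Df = Ck_on_Suc_has_derivative[OF Suc.prems(1) gx]
    interpret Df: bounded_linear "frechet_derivative f (at (g x))"
      using Df by (rule has_derivative_bounded_linear)
    have "frechet_derivative f (at (g x)) w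
        = (\<Sum>b\<in>Basis. (w \<bullet> b) *\<^sub>R frechet_derivative f (at (g x)) b)" for w
      using arg_cong[OF euclidean_representation[of w], of "frechet_derivative f (at (g x))"]
      unfolding Df.sum Df.scaleR by (rule sym)
    then have "(\<lambda>v. frechet_derivative f (at (g x)) (frechet_derivative g (at x) v)) = ?D x"
      by (rule ext)
    with has_derivative_compose[OF Ck_on_Suc_has_derivative[OF Suc.prems(2) x] Df]
    show "((\<lambda>x. f (g x)) has_derivative ?D x) (at x)" by (rule subst[rotated])
  next
    fix v
    have "Ck_on k U (\<lambda>x. frechet_derivative f (at (g x)) b)" for b
      using Suc.prems(1) Ck_on_Suc_imp[OF Suc.prems(2)]
      by (intro Suc.IH[of "\<lambda>y. frechet_derivative f (at y) b"]) auto
    moreover have "Ck_on k U (\<lambda>x. frechet_derivative g (at x) v \<bullet> b)" for b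
      using Suc.prems by (intro bounded_linear.Ck_on[OF bounded_linear_inner_left assms(1)]) auto
    ultimately show "Ck_on k U (\<lambda>x. ?D x v)"
      by (intro Ck_on_sum bounded_bilinear.Ck_on[OF bounded_bilinear_scaleR] assms(1))
  qed
qed

section \<open>Closure properties of smooth maps\<close>

lemma smooth_on_compose:
  fixes g :: "'a::euclidean_space \<Rightarrow> 'b::euclidean_space"
  assumes "open U" "g ` U \<subseteq> V" "smooth_on V f" "smooth_on U g"
  shows "smooth_on U (f \<circ> g)"
  unfolding smooth_on_def o_def
proof
  show "Ck_on k U (\<lambda>x. f (g x))" for k
    by (rule Ck_on_compose[OF assms(1,2)]) (use assms(3,4) in \<open>auto simp only: smooth_on_def\<close>)
qed

lemma smooth_on_const: "smooth_on U (\<lambda>x. c)"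
  by (simp add: smooth_on_def Ck_on_const)

lemma smooth_on_add:
  "open U \<Longrightarrow> smooth_on U f \<Longrightarrow> smooth_on U g \<Longrightarrow> smooth_on U (\<lambda>x. f x + g x)"
  by (simp add: smooth_on_def Ck_on_add)

lemma (in bounded_linear) smooth_on:
  "open U \<Longrightarrow> smooth_on U g \<Longrightarrow> smooth_on U (\<lambda>x. f (g x))"
  by (simp add: smooth_on_def Ck_on)

lemma (in bounded_bilinear) smooth_on:
  "open U \<Longrightarrow> smooth_on U f \<Longrightarrow> smooth_on U g \<Longrightarrow> smooth_on U (\<lambda>x. prod (f x) (g x))"
  by (simp add: smooth_on_def Ck_on)

lemma smooth_on_ident: "open U \<Longrightarrow> smooth_on U (\<lambda>x. x)"
  by (simp add: smooth_on_def Ck_on_ident)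

lemma smooth_on_Pair:
  assumes "open U" "smooth_on U f" "smooth_on U g"
  shows "smooth_on U (\<lambda>x. (f x, g x))"
proof -
  have *: "bounded_linear (\<lambda>x. (x, 0))" "bounded_linear (\<lambda>x. (0, x))"
    by (auto intro!: bounded_linear_Pair bounded_linear_ident bounded_linear_zero)
  \<comment> \<open>Pairing reduces to addition after the linear embeddings of the two
    factors.\<close>
  have "smooth_on U (\<lambda>x. (f x, 0) + (0, g x))"
    by (intro smooth_on_add assms bounded_linear.smooth_on[OF *(1)]
        bounded_linear.smooth_on[OF *(2)])
  then show ?thesis by simp
qed

lemmas smooth_on_intros =
  smooth_on_const smooth_on_add smooth_on_ident smooth_on_Pair
  bounded_linear.smooth_on[OF bounded_linear_fst] bounded_linear.smooth_on[OF bounded_linear_snd]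
  bounded_bilinear.smooth_on[OF bounded_bilinear_scaleR]
  bounded_bilinear.smooth_on[OF bounded_bilinear_mult]
  bounded_bilinear.smooth_on[OF bounded_bilinear_alpha]

lemma smooth_on_has_derivative:
  "smooth_on U f \<Longrightarrow> x \<in> U \<Longrightarrow> (f has_derivative frechet_derivative f (at x)) (at x)"
  unfolding smooth_on_def by (rule Ck_on_Suc_has_derivative[where k = 0]) (erule spec)

lemma smooth_on_imp_continuous_on: "smooth_on U f \<Longrightarrow> continuous_on U f"
  unfolding smooth_on_def by (drule spec[of _ 0]) simp


section \<open>The coordinates on the group\<close>

definition lift_Phi :: "real \<Rightarrow> triple \<Rightarrow> (real^2) \<times> (real^2)" where
  "lift_Phi \<kappa> x = (fst x - (\<kappa> * fst (snd x)) *\<^sub>R snd (snd x), snd (snd x))"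

definition coset_rep :: "(real^2) \<times> (real^2) \<Rightarrow> triple" where
  "coset_rep y = (fst y, 0, snd y)"

lemma lift_Phi_coset_rep [simp]: "lift_Phi \<kappa> (coset_rep y) = y"
  by (simp add: lift_Phi_def coset_rep_def)

lemma smooth_on_lift_Phi: "open U \<Longrightarrow> smooth_on U (lift_Phi \<kappa>)"
proof -
  \<comment> \<open>\<open>smooth_on_intros\<close> covers sums but not differences, so the minus
    sign moves into the scalar.\<close>
  have eq: "lift_Phi \<kappa> =
      (\<lambda>x. (fst x + (- \<kappa> * fst (snd x)) *\<^sub>R snd (snd x), snd (snd x)))"
    by (auto simp: lift_Phi_def)
  show "open U \<Longrightarrow> smooth_on U (lift_Phi \<kappa>)"
    unfolding eq by (intro smooth_on_intros)
qed

lemma smooth_on_coset_rep: "open U \<Longrightarrow> smooth_on U coset_rep"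
  unfolding coset_rep_def by (intro smooth_on_intros)

lemma smooth_on_Ghat_mult: "open U \<Longrightarrow> smooth_on U (Ghat_mult \<kappa> h)"
proof -
  obtain z a l where h: "h = (z, a, l)" by (cases h)
  have eq: "Ghat_mult \<kappa> h =
     (\<lambda>x. (z + fst x + (\<kappa> / 3 * alpha l (snd (snd x))) *\<^sub>R (l + (1/2) *\<^sub>R snd (snd x))
              + (\<kappa> * fst (snd x)) *\<^sub>R l,
           a + fst (snd x) + 1/2 * alpha l (snd (snd x)), l + snd (snd x)))"
    by (auto simp: fun_eq_iff h)
  show "open U \<Longrightarrow> smooth_on U (Ghat_mult \<kappa> h)"
    unfolding eq by (intro smooth_on_intros)
qed

section \<open>Cosets as fibres of the coordinate map\<close>

lemma mem_proj_iff: "y \<in> proj \<kappa> x \<longleftrightarrow> lift_Phi \<kappa> y = lift_Phi \<kappa> x"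
proof -
  obtain z a l z' a' l' where xy: "x = (z, a, l)" "y = (z', a', l')" by (cases x; cases y)
  have "y \<in> proj \<kappa> x \<longleftrightarrow> (\<exists>b. z' = z + (\<kappa> * b) *\<^sub>R l \<and> a' = a + b \<and> l' = l)"
    by (auto simp: proj_def l_coset_def Ghat_def Gplus_def xy alpha_simps)
  \<comment> \<open>The middle components force \<open>b = a' - a\<close>; eliminating
    \<open>b\<close> leaves \<open>z - \<kappa> a l\<close> and \<open>l\<close> as the invariants
    of the coset.\<close>
  also have "\<dots> \<longleftrightarrow> z' = z + (\<kappa> * (a' - a)) *\<^sub>R l \<and> l' = l"
    by (metis add_diff_cancel_left' diff_add_cancel add.commute)
  also have "\<dots> \<longleftrightarrow> lift_Phi \<kappa> y = lift_Phi \<kappa> x"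
    by (auto simp: lift_Phi_def xy algebra_simps)
  finally show ?thesis .
qed

lemma proj_eq_iff: "proj \<kappa> x = proj \<kappa> y \<longleftrightarrow> lift_Phi \<kappa> x = lift_Phi \<kappa> y"
proof
  assume "proj \<kappa> x = proj \<kappa> y"
  then show "lift_Phi \<kappa> x = lift_Phi \<kappa> y" by (metis mem_proj_iff)
next
  assume "lift_Phi \<kappa> x = lift_Phi \<kappa> y"
  then show "proj \<kappa> x = proj \<kappa> y" by (simp add: set_eq_iff mem_proj_iff)
qed

lemma Phi_proj: "Phi \<kappa> (proj \<kappa> x) = lift_Phi \<kappa> x"
proof -
  have "(\<exists>z a l. proj \<kappa> x = proj \<kappa> (z, a, l) \<and> y = (z - (\<kappa> * a) *\<^sub>R l, l)) \<longleftrightarrow> y = lift_Phi \<kappa> x" for y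
    by (cases x) (auto simp: proj_eq_iff lift_Phi_def)
  then show ?thesis by (simp add: Phi_def)
qed

lemma N_eq_range: "N \<kappa> = range (proj \<kappa>)"
  by (auto simp: N_def LCOSETS_def proj_def Ghat_def)

lemma proj_in_N [simp]: "proj \<kappa> x \<in> N \<kappa>"
  by (simp add: N_eq_range)

lemma proj_lift_Phi: "proj \<kappa> (coset_rep (lift_Phi \<kappa> x)) = proj \<kappa> x"
  by (simp add: proj_eq_iff)

lemma proj_coset_rep_Phi: "p \<in> N \<kappa> \<Longrightarrow> proj \<kappa> (coset_rep (Phi \<kappa> p)) = p"
  by (clarsimp simp: N_eq_range Phi_proj proj_lift_Phi)

lemma inj_on_Phi: "inj_on (Phi \<kappa>) (N \<kappa>)"
  by (metis inj_onI proj_coset_rep_Phi)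

lemma inv_into_Phi: "inv_into (N \<kappa>) (Phi \<kappa>) y = proj \<kappa> (coset_rep y)"
  by (rule inv_into_f_eq[OF inj_on_Phi]) (simp_all add: Phi_proj)

text \<open>Since \<open>proj \<kappa> \<circ> coset_rep\<close> inverts \<open>Phi\<close>, images
  under \<open>Phi\<close> become preimages, whose openness follows from continuity of
  \<open>coset_rep\<close>.\<close>

lemma Phi_image: "U \<subseteq> N \<kappa> \<Longrightarrow> Phi \<kappa> ` U = coset_rep -` (proj \<kappa> -` U)"
proof (intro subset_antisym subsetI)
  fix y assume "U \<subseteq> N \<kappa>" "y \<in> Phi \<kappa> ` U"
  then obtain p where "p \<in> N \<kappa>" "p \<in> U" "y = Phi \<kappa> p" by blast
  then show "y \<in> coset_rep -` (proj \<kappa> -` U)" by (simp add: proj_coset_rep_Phi)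
next
  fix y assume "y \<in> coset_rep -` (proj \<kappa> -` U)"
  then have "Phi \<kappa> (proj \<kappa> (coset_rep y)) \<in> Phi \<kappa> ` U" by (intro imageI) simp
  then show "y \<in> Phi \<kappa> ` U" by (simp add: Phi_proj)
qed

section \<open>The diffeomorphism\<close>

lemma topspace_N_topology: "topspace (N_topology \<kappa>) = N \<kappa>"
proof -
  have "proj \<kappa> -` N \<kappa> = UNIV" by auto
  then have "openin (N_topology \<kappa>) (N \<kappa>)" by (simp add: openin_N_topology)
  then show ?thesis
    by (metis openin_N_topology openin_subset openin_topspace subset_antisym)
qed

lemma N_diffeomorphism_Phi: "N_diffeomorphism \<kappa> (Phi \<kappa>)"
  unfolding N_diffeomorphism_def
proof (intro conjI allI impI)
  have preimage: "proj \<kappa> -` {p \<in> N \<kappa>. Phi \<kappa> p \<in> V} = lift_Phi \<kappa> -` V" for V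
    by (auto simp: Phi_proj)
  have open_lift: "open (lift_Phi \<kappa> -` V)" if "open V" for V
    using that smooth_on_imp_continuous_on[OF smooth_on_lift_Phi[of UNIV \<kappa>]]
    by (auto intro: open_vimage)
  have open_rep: "open (coset_rep -` W)" if "open W" for W
    using that smooth_on_imp_continuous_on[OF smooth_on_coset_rep[of UNIV]]
    by (auto intro: open_vimage)
  \<comment> \<open>Open sets of cosets are tested by their preimages in the group: continuity of
    \<open>Phi\<close> is that of \<open>lift_Phi\<close>, and openness of \<open>Phi\<close> is
    continuity of \<open>coset_rep\<close>.\<close>
  have "continuous_map (N_topology \<kappa>) euclidean (Phi \<kappa>)"
    unfolding continuous_map_def topspace_N_topology openin_N_topology preimage
    using open_lift by auto
  moreover have "open_map (N_topology \<kappa>) euclidean (Phi \<kappa>)"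
    by (auto simp: open_map_def openin_N_topology Phi_image open_rep)
  moreover have "Phi \<kappa> ` N \<kappa> = UNIV"
    by (auto simp: Phi_image)
  ultimately show "homeomorphic_map (N_topology \<kappa>) euclidean (Phi \<kappa>)"
    using inj_on_Phi
    by (intro bijective_open_imp_homeomorphic_map) (auto simp: topspace_N_topology)

  show "N_smooth_on \<kappa> {p \<in> N \<kappa>. Phi \<kappa> p \<in> V} (f \<circ> Phi \<kappa>)"
    if V: "open V \<and> smooth_on V f" for V and f :: "(real^2) \<times> (real^2) \<Rightarrow> real"
  proof -
    have "smooth_on (lift_Phi \<kappa> -` V) (f \<circ> lift_Phi \<kappa>)"
      using V by (intro smooth_on_compose[where V = V] smooth_on_lift_Phi open_lift) auto
    then show ?thesis
      by (simp only: N_smooth_on_def preimage o_def Phi_proj)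
  qed

  show "smooth_on (Phi \<kappa> ` U) (f \<circ> inv_into (N \<kappa>) (Phi \<kappa>))"
    if U: "openin (N_topology \<kappa>) U \<and> N_smooth_on \<kappa> U f" for U and f :: "triple set \<Rightarrow> real"
  proof -
    have "smooth_on (coset_rep -` (proj \<kappa> -` U)) ((f \<circ> proj \<kappa>) \<circ> coset_rep)"
      using U unfolding openin_N_topology N_smooth_on_def
      by (intro smooth_on_compose[OF _ image_vimage_subset] smooth_on_coset_rep open_rep) blast+
    moreover have "f \<circ> inv_into (N \<kappa>) (Phi \<kappa>) = f \<circ> proj \<kappa> \<circ> coset_rep"
      by (simp add: fun_eq_iff inv_into_Phi)
    ultimately show ?thesis
      using U by (simp only: openin_N_topology Phi_image)
  qed
qed


section \<open>Tangent vectors in coordinates\<close>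

lemma N_smooth_functions_iff: "f \<in> N_smooth_functions \<kappa> \<longleftrightarrow> smooth_on UNIV (f \<circ> proj \<kappa>)"
proof -
  have "proj \<kappa> -` N \<kappa> = UNIV" by auto
  then show ?thesis by (simp add: N_smooth_functions_def N_smooth_on_def)
qed

lemma transl_proj: "transl \<kappa> h (proj \<kappa> x) = proj \<kappa> (Ghat_mult \<kappa> h x)"
  by (force simp: transl_def proj_def l_coset_def Ghat_def Ghat_mult_assoc simp del: Ghat_mult.simps)

text \<open>Keeps \<open>f \<circ> transl \<kappa> h\<close> in the set outside which
  \<open>dproj\<close> is \<open>undefined\<close>, as evaluating \<open>dtransl\<close>
  requires.\<close>

lemma transl_N_smooth_functions:
  assumes "f \<in> N_smooth_functions \<kappa>"
  shows "f \<circ> transl \<kappa> h \<in> N_smooth_functions \<kappa>"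
proof -
  have "smooth_on UNIV ((f \<circ> proj \<kappa>) \<circ> Ghat_mult \<kappa> h)"
    using assms unfolding N_smooth_functions_iff
    by (intro smooth_on_compose[where V = UNIV] smooth_on_Ghat_mult) auto
  then show ?thesis by (simp add: N_smooth_functions_iff o_def transl_proj)
qed

lemma Phi_component_smooth: "(\<lambda>p. Phi \<kappa> p \<bullet> b) \<in> N_smooth_functions \<kappa>"
  unfolding N_smooth_functions_iff o_def Phi_proj
  by (intro bounded_linear.smooth_on[OF bounded_linear_inner_left] smooth_on_lift_Phi) auto

text \<open>The differential of \<open>lift_Phi\<close> at the first argument; the two terms with
  \<kappa> come from the product rule for \<open>a *\<^sub>R l\<close>.\<close>

fun dlift :: "real \<Rightarrow> triple \<Rightarrow> triple \<Rightarrow> (real^2) \<times> (real^2)" where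
  "dlift \<kappa> (z, a, l) (z', a', l') = (z' - (\<kappa> * a') *\<^sub>R l - (\<kappa> * a) *\<^sub>R l', l')"

lemma has_derivative_lift_Phi: "(lift_Phi \<kappa> has_derivative dlift \<kappa> g) (at g)"
proof -
  obtain z a l where g: "g = (z, a, l)" by (cases g)
  have "(lift_Phi \<kappa> has_derivative (\<lambda>x. (fst x - ((\<kappa> * a) *\<^sub>R snd (snd x)
      + (\<kappa> * fst (snd x)) *\<^sub>R l), snd (snd x)))) (at g)"
    unfolding lift_Phi_def
    by (rule derivative_eq_intros refl)+ (auto simp: fun_eq_iff g)
  also have "(\<lambda>x. (fst x - ((\<kappa> * a) *\<^sub>R snd (snd x) + (\<kappa> * fst (snd x)) *\<^sub>R l), snd (snd x)))
      = dlift \<kappa> g"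
    by (auto simp: fun_eq_iff g algebra_simps)
  finally show ?thesis .
qed

lemma has_derivative_Ghat_mult: "(Ghat_mult \<kappa> h has_derivative (\<lambda>X. left_inv_field \<kappa> X h)) (at 0)"
  using smooth_on_has_derivative[OF smooth_on_Ghat_mult[of UNIV \<kappa> h]]
  by (simp add: left_inv_field_def[abs_def] Ghat_def)

text \<open>\<open>f \<circ> proj \<kappa>\<close> factors through \<open>lift_Phi\<close> as the
  chart expression \<open>f \<circ> proj \<kappa> \<circ> coset_rep\<close>, because
  \<open>coset_rep (lift_Phi \<kappa> x)\<close> lies in the coset of \<open>x\<close>; the chain
  rule does the rest.\<close>

lemma has_derivative_comp_proj:
  assumes "f \<in> N_smooth_functions \<kappa>"
  shows "((f \<circ> proj \<kappa>) has_derivative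
      (\<lambda>X. frechet_derivative (f \<circ> proj \<kappa> \<circ> coset_rep) (at (lift_Phi \<kappa> g)) (dlift \<kappa> g X))) (at g)"
proof -
  let ?F = "f \<circ> proj \<kappa> \<circ> coset_rep"
  have "smooth_on UNIV ?F"
    using assms unfolding N_smooth_functions_iff
    by (intro smooth_on_compose[where V = UNIV] smooth_on_coset_rep) auto
  then have "(?F has_derivative frechet_derivative ?F (at (lift_Phi \<kappa> g))) (at (lift_Phi \<kappa> g))"
    by (rule smooth_on_has_derivative) simp
  from has_derivative_compose[OF has_derivative_lift_Phi this]
  show ?thesis by (simp add: o_def proj_lift_Phi)
qed

text \<open>The derivation with components \<open>w\<close> at the point \<open>y\<close> of the
  chart. It is restricted like \<open>dproj\<close> and \<open>dtransl\<close>, so that tangent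
  vectors can be compared as plain functions.\<close>

definition coord_vector :: "real \<Rightarrow> (real^2) \<times> (real^2) \<Rightarrow> (real^2) \<times> (real^2)
    \<Rightarrow> (triple set \<Rightarrow> real) \<Rightarrow> real" where
  "coord_vector \<kappa> y w =
     (\<lambda>f\<in>N_smooth_functions \<kappa>. frechet_derivative (f \<circ> proj \<kappa> \<circ> coset_rep) (at y) w)"

lemma dproj_eq_coord_vector: "dproj \<kappa> g X = coord_vector \<kappa> (lift_Phi \<kappa> g) (dlift \<kappa> g X)"
  unfolding dproj_def coord_vector_def
  by (intro restrict_ext) (simp add: frechet_derivative_at[OF has_derivative_comp_proj, symmetric])

text \<open>On the group, translation of cosets is left multiplication by \<open>h\<close>, whose
  differential at the identity is the left-invariant field; \<open>dlift\<close> carries the result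
  to the chart.\<close>

lemma dtransl_dproj_eq_coord_vector:
  "dtransl \<kappa> h (dproj \<kappa> \<one>\<^bsub>Ghat \<kappa>\<^esub> X)
   = coord_vector \<kappa> (lift_Phi \<kappa> h) (dlift \<kappa> h (left_inv_field \<kappa> X h))"
  unfolding dtransl_def coord_vector_def
proof (intro restrict_ext)
  fix f assume f: "f \<in> N_smooth_functions \<kappa>"
  have "Ghat_mult \<kappa> h 0 = h"
    by (cases h) (simp add: zero_prod_def alpha_simps)
  then have "((f \<circ> proj \<kappa> \<circ> Ghat_mult \<kappa> h) has_derivative
      (\<lambda>X. frechet_derivative (f \<circ> proj \<kappa> \<circ> coset_rep) (at (lift_Phi \<kappa> h))
        (dlift \<kappa> h (left_inv_field \<kappa> X h)))) (at 0)"
    using has_derivative_compose[OF has_derivative_Ghat_mult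
        has_derivative_comp_proj[OF f, of "Ghat_mult \<kappa> h 0"]] by (simp add: o_def)
  from frechet_derivative_at[OF this, symmetric]
  have "frechet_derivative (f \<circ> transl \<kappa> h \<circ> proj \<kappa>) (at 0) X =
     frechet_derivative (f \<circ> proj \<kappa> \<circ> coset_rep) (at (lift_Phi \<kappa> h))
        (dlift \<kappa> h (left_inv_field \<kappa> X h))"
    by (simp add: o_def transl_proj)
  then show "dproj \<kappa> \<one>\<^bsub>Ghat \<kappa>\<^esub> X (f \<circ> transl \<kappa> h) =
     frechet_derivative (f \<circ> proj \<kappa> \<circ> coset_rep) (at (lift_Phi \<kappa> h))
        (dlift \<kappa> h (left_inv_field \<kappa> X h))"
    by (simp add: dproj_def transl_N_smooth_functions[OF f] Ghat_def zero_prod_def)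
qed

text \<open>In the chart the components of \<open>Phi\<close> are linear functions, so the
  derivation returns the components of \<open>w\<close>. In particular it determines
  \<open>w\<close>.\<close>

lemma N_differential_Phi: "N_differential (Phi \<kappa>) (coord_vector \<kappa> y w) = w"
proof -
  have "coord_vector \<kappa> y w (\<lambda>p. Phi \<kappa> p \<bullet> b) = w \<bullet> b" for b
  proof -
    have "((\<lambda>x. x \<bullet> b) has_derivative (\<lambda>x. x \<bullet> b)) (at y)"
      by (intro derivative_intros)
    from frechet_derivative_at[OF this, symmetric] show ?thesis
      by (simp add: coord_vector_def Phi_component_smooth o_def Phi_proj)
  qed
  then show ?thesis by (simp add: N_differential_def euclidean_representation)
qed

section \<open>The metric in coordinates\<close>

lemma lie_of_in_lie_minus_iff: "lie_of (z, a, l) \<in> lie_minus \<longleftrightarrow> a = 0"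
  by (auto simp: lie_minus_def)

text \<open>Let \<open>u\<close>, \<open>y\<close>, \<open>y'\<close> be the last components of
  \<open>h\<close>, \<open>X\<close>, \<open>Y\<close>. The terms
  \<open>- (\<kappa>/6) \<alpha>(u, y) u\<close> and \<open>- (\<kappa>/6) \<alpha>(u, y') u\<close>
  of the two vectors each contribute \<open>(\<kappa>/6) \<alpha>(u, y) \<alpha>(u, y')\<close>,
  which cancels the square term of the metric; the terms with \<open>\<kappa> a\<close> cancel
  because \<open>alpha\<close> is antisymmetric.\<close>

lemma coord_metric_eq_lie_form:
  assumes "lie_of X \<in> lie_minus" "lie_of Y \<in> lie_minus"
  shows "coord_metric \<kappa> (lift_Phi \<kappa> h) (dlift \<kappa> h (left_inv_field \<kappa> X h))
      (dlift \<kappa> h (left_inv_field \<kappa> Y h)) = lie_form \<kappa> (lie_of X) (lie_of Y)"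
proof -
  obtain z a l x c y x' c' y' where "h = (z, a, l)" "X = (x, c, y)" "Y = (x', c', y')"
    by (cases h; cases X; cases Y)
  with assms show ?thesis
    \<comment> \<open>\<open>lie_of\<close> stays folded at first, so that the assumptions can be
      matched and reduce to vanishing middle components; the second pass unfolds it.\<close>
    by (simp add: lie_of_in_lie_minus_iff left_inv_field_eq coord_metric_def lift_Phi_def Let_def
        sym_prod_def du_def dv_def inner_vec_def sum_2 alpha_def axis_def field_simps
        del: lie_of.simps)
      (simp add: alpha_def axis_def inner_vec_def sum_2 field_simps)
qed

lemma ex_lie_minus_left_inv_field:
  "\<exists>X. lie_of X \<in> lie_minus \<and> dlift \<kappa> h (left_inv_field \<kappa> X h) = w"
proof -
  obtain z a l v u where hw: "h = (z, a, l)" "w = (v, u)" by (cases h; cases w)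
  \<comment> \<open>For the triple \<open>(z', 0, u)\<close> the image has first component
    \<open>z' - (\<kappa>/6) \<alpha>(l, u) l - \<kappa> a u\<close>; setting this equal to
    \<open>v\<close> gives \<open>z'\<close>.\<close>
  let ?X = "(v + (\<kappa> / 6 * alpha l u) *\<^sub>R l + (\<kappa> * a) *\<^sub>R u, 0, u)"
  have "dlift \<kappa> h (left_inv_field \<kappa> ?X h) = w"
    by (simp add: hw left_inv_field_eq vec_eq_iff field_simps)
  then show ?thesis using lie_of_in_lie_minus_iff by blast
qed

text \<open>Every admissible \<open>g\<close>, \<open>X\<close>, \<open>Y\<close> yields the
  coordinate value, which mentions only \<open>p\<close>, \<open>\<xi>\<close> and
  \<open>\<eta>\<close>. So independence of the choice of \<open>g\<close> comes with the
  computation, and surjectivity onto the tangent space gives existence.\<close>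

lemma N_metric_eq_coord_metric:
  assumes "p \<in> N \<kappa>" "\<xi> \<in> N_tangent_space \<kappa> p" "\<eta> \<in> N_tangent_space \<kappa> p"
  shows "N_metric \<kappa> p \<xi> \<eta> =
    coord_metric \<kappa> (Phi \<kappa> p) (N_differential (Phi \<kappa>) \<xi>) (N_differential (Phi \<kappa>) \<eta>)"
proof -
  have transl_Gplus: "transl \<kappa> g Gplus = proj \<kappa> g" for g
    by (simp add: transl_def proj_def)
  \<comment> \<open>Tangent vectors at \<open>p\<close> may arise at different representatives, but
    all of these have the same chart point \<open>Phi \<kappa> p\<close>.\<close>
  have "\<exists>w. \<zeta> = coord_vector \<kappa> (Phi \<kappa> p) w" if "\<zeta> \<in> N_tangent_space \<kappa> p" for \<zeta>
    using that unfolding N_tangent_space_def dproj_eq_coord_vector by (auto simp flip: Phi_proj)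
  then obtain w w' where w: "\<xi> = coord_vector \<kappa> (Phi \<kappa> p) w" "\<eta> = coord_vector \<kappa> (Phi \<kappa> p) w'"
    using assms(2,3) by meson
  let ?r = "coord_metric \<kappa> (Phi \<kappa> p) (N_differential (Phi \<kappa>) \<xi>) (N_differential (Phi \<kappa>) \<eta>)"
  show ?thesis
    unfolding N_metric_def
  proof (rule the_equality)
    obtain h where h: "p = proj \<kappa> h" using assms(1) by (auto simp: N_eq_range)
    obtain X Y where "lie_of X \<in> lie_minus" "dlift \<kappa> h (left_inv_field \<kappa> X h) = w"
      "lie_of Y \<in> lie_minus" "dlift \<kappa> h (left_inv_field \<kappa> Y h) = w'"
      using ex_lie_minus_left_inv_field by metis
    then show "\<exists>g X Y. lie_of X \<in> lie_minus \<and> lie_of Y \<in> lie_minus \<and>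
        p = transl \<kappa> g Gplus \<and>
        \<xi> = dtransl \<kappa> g (dproj \<kappa> \<one>\<^bsub>Ghat \<kappa>\<^esub> X) \<and>
        \<eta> = dtransl \<kappa> g (dproj \<kappa> \<one>\<^bsub>Ghat \<kappa>\<^esub> Y) \<and>
        ?r = lie_form \<kappa> (lie_of X) (lie_of Y)"
      using coord_metric_eq_lie_form[of X Y \<kappa> h]
      by (intro exI[of _ h] exI[of _ X] exI[of _ Y])
        (simp add: transl_Gplus h w dtransl_dproj_eq_coord_vector Phi_proj N_differential_Phi)
  next
    fix r
    assume "\<exists>g X Y. lie_of X \<in> lie_minus \<and> lie_of Y \<in> lie_minus \<and>
        p = transl \<kappa> g Gplus \<and>
        \<xi> = dtransl \<kappa> g (dproj \<kappa> \<one>\<^bsub>Ghat \<kappa>\<^esub> X) \<and>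
        \<eta> = dtransl \<kappa> g (dproj \<kappa> \<one>\<^bsub>Ghat \<kappa>\<^esub> Y) \<and>
        r = lie_form \<kappa> (lie_of X) (lie_of Y)"
    then show "r = ?r"
      by (auto simp: transl_Gplus dtransl_dproj_eq_coord_vector N_differential_Phi Phi_proj
          coord_metric_eq_lie_form)
  qed
qed

section \<open>The isometry action in coordinates\<close>

lemma Phi_isom_act:
  assumes "S \<in> SLpm"
  shows "Phi \<kappa> (isom_act \<kappa> ((z, a, l), S) (inv_into (N \<kappa>) (Phi \<kappa>) (v, u))) =
     (det S *\<^sub>R (S *v v) + z - (\<kappa> / 3 * alpha l (S *v u)) *\<^sub>R (S *v u + (1/2) *\<^sub>R l)
        - (\<kappa> * a) *\<^sub>R (S *v u + l),
      S *v u + l)"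
  \<comment> \<open>Evaluated on the representative \<open>(v, 0, u)\<close>: the product has middle
    component \<open>a + \<alpha>(l, Su)/2\<close>, and subtracting \<kappa> times this multiple of
    \<open>Su + l\<close> turns \<open>(\<kappa>/3) \<alpha>(l, Su) (l + Su/2)\<close> into the
    stated term.\<close>
  by (simp add: inv_into_Phi isom_act_proj[OF assms] Phi_proj coset_rep_def Ghat_def lift_Phi_def
      vec_eq_iff field_simps)

theorem proposition4p16:
  fixes \<kappa> :: real
  assumes "\<kappa> \<in> {1, -1}"
  shows "(\<forall>z a l. Phi \<kappa> (proj \<kappa> (z, a, l)) = (z - (\<kappa> * a) *\<^sub>R l, l))
    \<and> N_diffeomorphism \<kappa> (Phi \<kappa>)
    \<and> (\<forall>p\<in>N \<kappa>. \<forall>\<xi>\<in>N_tangent_space \<kappa> p. \<forall>\<eta>\<in>N_tangent_space \<kappa> p.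
         N_metric \<kappa> p \<xi> \<eta> =
         coord_metric \<kappa> (Phi \<kappa> p) (N_differential (Phi \<kappa>) \<xi>) (N_differential (Phi \<kappa>) \<eta>))
    \<and> (\<forall>z a l S v u. ((z, a, l), S) \<in> carrier (isom_group \<kappa>) \<longrightarrow>
         Phi \<kappa> (isom_act \<kappa> ((z, a, l), S) (inv_into (N \<kappa>) (Phi \<kappa>) (v, u))) =
         (det S *\<^sub>R (S *v v) + z - (\<kappa> / 3 * alpha l (S *v u)) *\<^sub>R (S *v u + (1/2) *\<^sub>R l)
            - (\<kappa> * a) *\<^sub>R (S *v u + l),
          S *v u + l))"
proof (intro conjI ballI allI impI)
  show "Phi \<kappa> (proj \<kappa> (z, a, l)) = (z - (\<kappa> * a) *\<^sub>R l, l)" for z a l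
    by (simp add: Phi_proj lift_Phi_def)
qed (simp_all add: N_diffeomorphism_Phi N_metric_eq_coord_metric Phi_isom_act isom_group_def)

end
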